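(* Let $(x_n)_{n\in\mathbb N}\subseteq[0,1]$. The following are equivalent: (i) $(x_n)_{n\in\mathbb N}$ is uniformly distributed mod $1$; (ii) $(x_n)_{n\in\mathbb N}$ has $0$--PPC, i.e. $\lim_{N\to\infty}R_2(0;s,N)=2s$ for all $0<s\leqslant\frac12$.
   Context: For $x\in\mathbb R$, $\|x\|$ denotes the distance from $x$ to the nearest integer. For a sequence $(x_n)\subseteq[0,1]$, $0\leqslant\beta\leqslant1$, $s>0$ and $N\geqslant1$, the pair correlation function with parameter $\beta$ is $R_2(\beta;s,N)=\frac{1}{N^{2-\beta}}\#\{(m,n):1\leqslant m,n\leqslant N,\ m\neq n,\ \|x_m-x_n\|\leqslant s/N^{\beta}\}$. A sequence is uniformly distributed mod $1$ if $\lim_{N\to\infty}\frac1N\#\{i\leqslant N: x_i\in[a,b]\}=b-a$ for all $0\leqslant a<b\leqslant1$. *)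

theory Defs
  imports "HOL-Analysis.Analysis"
begin

text \<open>Sequences are indexed by the positive integers; the value at index 0 is never used.\<close>

definition dist_nearest_int :: "real \<Rightarrow> real" where
  "dist_nearest_int x = infdist x \<int>"

definition pair_correlation :: "(nat \<Rightarrow> real) \<Rightarrow> real \<Rightarrow> real \<Rightarrow> nat \<Rightarrow> real" where
  "pair_correlation x \<beta> s N =
     1 / (real N powr (2 - \<beta>)) *
     real (card {(m, n). 1 \<le> m \<and> m \<le> N \<and> 1 \<le> n \<and> n \<le> N \<and> m \<noteq> n \<and>
                         dist_nearest_int (x m - x n) \<le> s / (real N powr \<beta>)})"

definition uniformly_distributed_mod1 :: "(nat \<Rightarrow> real) \<Rightarrow> bool" where
  "uniformly_distributed_mod1 x \<longleftrightarrow>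
     (\<forall>a b. 0 \<le> a \<and> a < b \<and> b \<le> 1 \<longrightarrow>
        (\<lambda>N. 1 / real N * real (card {i. 1 \<le> i \<and> i \<le> N \<and> x i \<in> {a..b}})) \<longlonglongrightarrow> b - a)"

definition has_zero_PPC :: "(nat \<Rightarrow> real) \<Rightarrow> bool" where
  "has_zero_PPC x \<longleftrightarrow>
     (\<forall>s. 0 < s \<and> s \<le> 1 / 2 \<longrightarrow> (\<lambda>N. pair_correlation x 0 s N) \<longlonglongrightarrow> 2 * s)"

end

theory Submission
  imports Defs
begin

text \<open>
  Uniform distribution implies zero PPC: for \<open>s < 1/2\<close> the indicator of \<open>\<parallel>y\<parallel> \<le> s\<close> is
  \<open>\<lfloor>s + y\<rfloor> + \<lfloor>s - y\<rfloor> + 1\<close>, so the number of close pairs is a double sum of \<open>\<lfloor>s + x\<^sub>m - x\<^sub>n\<rfloor>\<close>.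
  Under uniform distribution the average of \<open>\<lfloor>t - x\<^sub>n\<rfloor>\<close> over \<open>n\<close> tends to \<open>t - 1\<close>, uniformly
  in \<open>t\<close> by monotonicity, and the average of \<open>x\<^sub>m\<close> tends to \<open>1/2\<close>.

  Conversely, let \<open>\<mu>(t)\<close> be the proportion of the first \<open>N\<close> points in the arc of length
  \<open>h < 1/2\<close> starting at \<open>t\<close>. The arcs of two points at distance \<open>d\<close> overlap in length
  \<open>max 0 (h - d) = \<integral>\<^sub>0\<^sup>h 1[d \<le> s] ds\<close>, so \<open>\<integral> \<mu>\<^sup>2\<close> tends to \<open>\<integral>\<^sub>0\<^sup>h 2s ds = h\<^sup>2\<close>. As \<open>\<mu>\<close> has
  mean \<open>h\<close>, its variance tends to 0. Averaging \<open>\<mu>\<close> over the arcs inside \<open>[a, b]\<close> bounds the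
  proportion of points in \<open>[a, b]\<close> from below, up to \<open>O(h)\<close>, by \<open>b - a\<close>; applying this to the
  complement gives the upper bound.
\<close>

section \<open>Distance to the nearest integer\<close>

lemma dist_nearest_int_attained:
  obtains k :: int where "dist_nearest_int y = \<bar>y - of_int k\<bar>"
proof -
  obtain z :: real where "z \<in> \<int>" "infdist y \<int> = dist y z"
    using infdist_attains_inf[of "\<int> :: real set" y] by (metis Ints_0 closed_Ints empty_iff)
  then show ?thesis
    using that by (auto simp: dist_nearest_int_def dist_real_def elim!: Ints_cases)
qed

lemma dist_nearest_int_le: "dist_nearest_int y \<le> \<bar>y - of_int k\<bar>"
  unfolding dist_nearest_int_def using infdist_le[of "of_int k" "\<int> :: real set" y]
  by (simp add: dist_real_def)

lemma dist_nearest_int_le_iff: "dist_nearest_int y \<le> s \<longleftrightarrow> (\<exists>k::int. \<bar>y - of_int k\<bar> \<le> s)"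
  by (metis dist_nearest_int_attained dist_nearest_int_le order_trans)

lemma dist_nearest_int_0 [simp]: "dist_nearest_int 0 = 0"
  by (simp add: dist_nearest_int_def)

lemma dist_nearest_int_le_half: "dist_nearest_int y \<le> 1 / 2"
  by (metis dist_nearest_int_le of_int_round_abs_le abs_minus_commute order_trans)

text \<open>The largest integer below \<open>y + s\<close> is \<open>\<lfloor>s + y\<rfloor>\<close>
  and the smallest one above \<open>y - s\<close> is \<open>- \<lfloor>s - y\<rfloor>\<close>, so
  the right side counts the integers in \<open>[y - s, y + s]\<close>. As \<open>2 * s < 1\<close>,
  there is at most one.\<close>

lemma of_bool_dist_nearest_int_le:
  assumes "0 \<le> s" "s < 1 / 2"
  shows "(of_bool (dist_nearest_int y \<le> s) :: real) = of_int \<lfloor>s + y\<rfloor> + of_int \<lfloor>s - y\<rfloor> + 1"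
proof (cases "dist_nearest_int y \<le> s")
  case True
  then obtain k :: int where k: "\<bar>y - of_int k\<bar> \<le> s"
    by (auto simp: dist_nearest_int_le_iff)
  have "\<lfloor>s + y\<rfloor> = k" "\<lfloor>s - y\<rfloor> = - k"
    using k assms by (auto simp: floor_eq_iff)
  with True show ?thesis by simp
next
  case False
  define k where "k = \<lfloor>y\<rfloor>"
  have k: "of_int k \<le> y" "y < of_int k + 1" unfolding k_def by linarith+
  have *: "s < \<bar>y - of_int j\<bar>" for j :: int
    using False dist_nearest_int_le[of y j] by linarith
  \<comment> \<open>Here \<open>k + s < y < k + 1 - s\<close>.\<close>
  have "\<lfloor>s + y\<rfloor> = k" "\<lfloor>s - y\<rfloor> = - k - 1"
    using k *[of k] *[of "k + 1"] assms by (auto simp: floor_eq_iff)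
  with False show ?thesis by simp
qed

section \<open>Pair counts\<close>

text \<open>The diagonal \<open>m = n\<close> is kept so that the double sum runs over a full
  square. For \<open>s \<ge> 0\<close> it contributes only \<open>1 / N\<close>.\<close>

definition close_pairs :: "(nat \<Rightarrow> real) \<Rightarrow> real \<Rightarrow> nat \<Rightarrow> real" where
  "close_pairs x s N =
     (\<Sum>m=1..N. \<Sum>n=1..N. of_bool (dist_nearest_int (x m - x n) \<le> s)) / (real N)\<^sup>2"

lemma pair_correlation_zero:
  assumes "0 \<le> s" "N \<ge> 1"
  shows "pair_correlation x 0 s N = close_pairs x s N - 1 / real N"
proof -
  define D where "D = (\<lambda>(m, n). dist_nearest_int (x m - x n) \<le> s)"
  define A where "A = {p \<in> {1..N} \<times> {1..N}. D p \<and> fst p \<noteq> snd p}"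
  define B where "B = (\<lambda>n. (n, n)) ` {1..N}"
  have fin: "finite A" "finite B" by (auto simp: A_def B_def)
  have disj: "A \<inter> B = {}" by (auto simp: A_def B_def)
  have AB: "A \<union> B = ({1..N} \<times> {1..N}) \<inter> {p. D p}"
    using assms by (auto simp: A_def B_def D_def)
  have cB: "card B = N" unfolding B_def by (subst card_image) (auto simp: inj_on_def)
  have "(\<Sum>m=1..N. \<Sum>n=1..N. of_bool (dist_nearest_int (x m - x n) \<le> s))
      = (\<Sum>p\<in>{1..N} \<times> {1..N}. of_bool (D p) :: real)"
    unfolding sum.cartesian_product by (intro sum.cong) (auto simp: D_def)
  also have "\<dots> = real (card (A \<union> B))"
    by (subst sum_of_bool_eq) (auto simp: AB)
  also have "\<dots> = real (card A) + real N"
    using card_Un_disjoint[OF fin disj] cB by simp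
  finally have *: "(\<Sum>m=1..N. \<Sum>n=1..N. of_bool (dist_nearest_int (x m - x n) \<le> s))
      = real (card A) + real N" .
  have A: "{(m, n). 1 \<le> m \<and> m \<le> N \<and> 1 \<le> n \<and> n \<le> N \<and> m \<noteq> n \<and>
             dist_nearest_int (x m - x n) \<le> s / (real N powr 0)} = A"
    using assms by (auto simp: A_def D_def)
  have p: "real N powr (2 - 0) = (real N)\<^sup>2"
    using assms by simp
  show ?thesis
    unfolding pair_correlation_def close_pairs_def * A p
    using assms by (simp add: field_simps power2_eq_square)
qed

lemma has_zero_PPC_iff_close_pairs:
  "has_zero_PPC x \<longleftrightarrow> (\<forall>s. 0 < s \<and> s \<le> 1 / 2 \<longrightarrow> close_pairs x s \<longlonglongrightarrow> 2 * s)"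
proof -
  have "(\<lambda>N. pair_correlation x 0 s N) \<longlonglongrightarrow> 2 * s \<longleftrightarrow> close_pairs x s \<longlonglongrightarrow> 2 * s" if "0 < s" for s
  proof -
    have ev: "eventually (\<lambda>N. pair_correlation x 0 s N = close_pairs x s N - 1 / real N) sequentially"
      using eventually_ge_at_top[of 1] by eventually_elim (use that pair_correlation_zero in auto)
    have "(\<lambda>N. pair_correlation x 0 s N) \<longlonglongrightarrow> 2 * s
        \<longleftrightarrow> (\<lambda>N. close_pairs x s N - 1 / real N) \<longlonglongrightarrow> 2 * s"
      by (rule tendsto_cong[OF ev])
    also have "\<dots> \<longleftrightarrow> close_pairs x s \<longlonglongrightarrow> 2 * s"
      using tendsto_add[of "\<lambda>N. close_pairs x s N - 1 / real N" "2 * s" sequentially "\<lambda>N. 1 / real N" 0]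
        tendsto_diff[of "close_pairs x s" "2 * s" sequentially "\<lambda>N. 1 / real N" 0] lim_1_over_n
      by auto
    finally show ?thesis .
  qed
  then show ?thesis unfolding has_zero_PPC_def by blast
qed

section \<open>Visit frequencies\<close>

definition visit_freq :: "(nat \<Rightarrow> real) \<Rightarrow> real set \<Rightarrow> nat \<Rightarrow> real" where
  "visit_freq x S N = (\<Sum>n=1..N. of_bool (x n \<in> S)) / real N"

lemma uniformly_distributed_mod1_iff_visit_freq:
  "uniformly_distributed_mod1 x \<longleftrightarrow>
     (\<forall>a b. 0 \<le> a \<and> a < b \<and> b \<le> 1 \<longrightarrow> visit_freq x {a..b} \<longlonglongrightarrow> b - a)"
proof -
  have "visit_freq x S = (\<lambda>N. 1 / real N * real (card {i. 1 \<le> i \<and> i \<le> N \<and> x i \<in> S}))" for S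
  proof
    fix N
    have "{1..N} \<inter> {n. x n \<in> S} = {i. 1 \<le> i \<and> i \<le> N \<and> x i \<in> S}" by auto
    then show "visit_freq x S N = 1 / real N * real (card {i. 1 \<le> i \<and> i \<le> N \<and> x i \<in> S})"
      by (simp add: visit_freq_def)
  qed
  then show ?thesis by (simp add: uniformly_distributed_mod1_def)
qed

lemma visit_freq_nonneg: "0 \<le> visit_freq x S N"
  unfolding visit_freq_def by (intro divide_nonneg_nonneg sum_nonneg) auto

lemma visit_freq_mono: "S \<subseteq> T \<Longrightarrow> visit_freq x S N \<le> visit_freq x T N"
  unfolding visit_freq_def by (intro divide_right_mono sum_mono) auto

section \<open>Integrals of floor functions over the unit interval\<close>

abbreviation unit_lborel :: "real measure" where
  "unit_lborel \<equiv> restrict_space lborel {0..1}"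

lemma finite_measure_unit_lborel: "finite_measure unit_lborel"
  by (rule finite_measureI) (simp add: space_restrict_space emeasure_restrict_space)

lemma measure_unit_lborel: "A \<in> sets borel \<Longrightarrow> A \<subseteq> {0..1} \<Longrightarrow> measure unit_lborel A = measure lborel A"
  by (simp add: measure_restrict_space)

lemma integrable_unit_lborel:
  fixes f :: "real \<Rightarrow> real"
  assumes "f \<in> borel_measurable borel" "\<And>t. t \<in> {0..1} \<Longrightarrow> \<bar>f t\<bar> \<le> B"
  shows "integrable unit_lborel f"
proof (rule finite_measure.integrable_const_bound[OF finite_measure_unit_lborel, where B = B])
  show "AE t in unit_lborel. norm (f t) \<le> B"
    by (rule AE_I2) (use assms(2) in \<open>auto simp: space_restrict_space\<close>)
  show "f \<in> borel_measurable unit_lborel"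
    using assms(1) by (intro measurable_restrict_space1) simp
qed

lemma integrable_const_unit_lborel: "integrable unit_lborel (\<lambda>t. c :: real)"
  by (rule integrable_unit_lborel[where B = "\<bar>c\<bar>"]) auto

lemma integral_const_unit_lborel: "(\<integral>t. c \<partial>unit_lborel) = (c :: real)"
  by (simp add: measure_unit_lborel space_restrict_space)

lemma integrable_floor_diff: "integrable unit_lborel (\<lambda>t. of_int \<lfloor>t - c\<rfloor> :: real)"
proof (rule integrable_unit_lborel)
  show "\<bar>of_int \<lfloor>t - c\<rfloor>\<bar> \<le> \<bar>c\<bar> + 2" if "t \<in> {0..1}" for t :: real
    using that by (simp, linarith)
qed measurable

text \<open>Split \<open>- c\<close> into integer part \<open>k\<close> and fractional part
  \<open>f\<close>: on the unit interval the floor is \<open>k\<close> before \<open>1 - f\<close>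
  and \<open>k + 1\<close> from there on.\<close>

lemma integral_floor_diff: "(\<integral>t. of_int \<lfloor>t - c\<rfloor> \<partial>unit_lborel) = - c"
proof -
  define k f where "k = \<lfloor>- c\<rfloor>" and "f = frac (- c)"
  have f: "0 \<le> f" "f < 1" "of_int k + f = - c"
    by (auto simp: f_def k_def frac_lt_1) (simp add: frac_def)
  have iI: "integrable unit_lborel (indicator {1 - f..1} :: real \<Rightarrow> real)"
    by (rule integrable_unit_lborel[where B = 1]) (auto simp: indicator_def)
  have "(\<integral>t. of_int \<lfloor>t - c\<rfloor> \<partial>unit_lborel :: real)
      = (\<integral>t. of_int k + indicator {1 - f..1} t \<partial>unit_lborel :: real)"
  proof (rule Bochner_Integration.integral_cong[OF refl])
    fix t assume "t \<in> space unit_lborel"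
    then have t: "0 \<le> t" "t \<le> 1" by (auto simp: space_restrict_space)
    have "\<lfloor>t - c\<rfloor> = k + of_bool (1 - f \<le> t)"
      using t f by (auto simp: floor_eq_iff)
    then show "of_int \<lfloor>t - c\<rfloor> = of_int k + indicator {1 - f..1} t"
      using t by (auto simp: indicator_def)
  qed
  also have "\<dots> = of_int k + (\<integral>t. indicator {1 - f..1} t \<partial>unit_lborel)"
    by (subst Bochner_Integration.integral_add[OF integrable_const_unit_lborel iI])
       (simp only: integral_const_unit_lborel)
  also have "(\<integral>t. indicator {1 - f..1} t \<partial>unit_lborel) = f"
  proof -
    have "{1 - f..1} \<inter> space unit_lborel = {1 - f..1}"
      using f by (auto simp: space_restrict_space)
    then show ?thesis using f
      by (simp add: measure_unit_lborel)
  qed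
  finally show ?thesis using f by simp
qed

section \<open>Uniform distribution implies zero PPC\<close>

text \<open>For points of the unit interval, \<open>0 < t < 1\<close> and \<open>N \<ge> 1\<close>,
  this is the empirical distribution function at \<open>t\<close> minus 1. The floor extends it to
  all real \<open>t\<close> without case distinctions for wrap-around.\<close>

definition floor_mean :: "(nat \<Rightarrow> real) \<Rightarrow> nat \<Rightarrow> real \<Rightarrow> real" where
  "floor_mean x N t = (\<Sum>n=1..N. of_int \<lfloor>t - x n\<rfloor>) / real N"

lemma floor_mean_mono: "t \<le> u \<Longrightarrow> floor_mean x N t \<le> floor_mean x N u"
  unfolding floor_mean_def by (intro divide_right_mono sum_mono) (auto intro: floor_mono)

lemma floor_mean_add_int:
  "N \<ge> 1 \<Longrightarrow> floor_mean x N (t + of_int k) = floor_mean x N t + of_int k"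
proof -
  assume "N \<ge> 1"
  have "\<lfloor>t + of_int k - x n\<rfloor> = \<lfloor>t - x n\<rfloor> + k" for n
    by (metis add_diff_eq add.commute diff_add_eq floor_add_int)
  then show ?thesis using \<open>N \<ge> 1\<close>
    by (simp add: floor_mean_def sum.distrib add_divide_distrib)
qed

text \<open>The two floor terms of the indicator have equal double sums, by exchanging
  \<open>m\<close> and \<open>n\<close>.\<close>

lemma close_pairs_eq_floor_mean:
  assumes "0 \<le> s" "s < 1 / 2" "N \<ge> 1"
  shows "close_pairs x s N = 2 * ((\<Sum>m=1..N. floor_mean x N (s + x m)) / real N) + 1"
proof -
  define S where "S = (\<Sum>m=1..N. \<Sum>n=1..N. of_int \<lfloor>s + x m - x n\<rfloor> :: real)"
  have "(\<Sum>m=1..N. \<Sum>n=1..N. of_bool (dist_nearest_int (x m - x n) \<le> s))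
     = (\<Sum>m=1..N. \<Sum>n=1..N. of_int \<lfloor>s + x m - x n\<rfloor> + of_int \<lfloor>s + x n - x m\<rfloor> + (1::real))"
    using assms by (intro sum.cong refl, subst of_bool_dist_nearest_int_le) (auto simp: algebra_simps)
  also have "\<dots> = S + (\<Sum>m=1..N. \<Sum>n=1..N. of_int \<lfloor>s + x n - x m\<rfloor> :: real) + (real N)\<^sup>2"
    by (simp add: sum.distrib S_def power2_eq_square)
  also have "(\<Sum>m=1..N. \<Sum>n=1..N. of_int \<lfloor>s + x n - x m\<rfloor> :: real) = S"
    unfolding S_def by (rule sum.swap)
  finally have "close_pairs x s N = (S + S + (real N)\<^sup>2) / (real N)\<^sup>2"
    by (simp add: close_pairs_def)
  moreover have "(\<Sum>m=1..N. floor_mean x N (s + x m)) = S / real N"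
    unfolding floor_mean_def S_def by (simp add: sum_divide_distrib)
  ultimately show ?thesis using assms by (simp add: power2_eq_square add_divide_distrib)
qed

context
  fixes x :: "nat \<Rightarrow> real"
  assumes unit: "\<And>n. n \<ge> 1 \<Longrightarrow> x n \<in> {0..1}"
begin

lemma floor_mean_tendsto:
  assumes ud: "uniformly_distributed_mod1 x"
  shows "(\<lambda>N. floor_mean x N t) \<longlonglongrightarrow> t - 1"
proof -
  have pos: "(\<lambda>N. floor_mean x N t) \<longlonglongrightarrow> t - 1" if t: "0 < t" "t < 1" for t
  proof -
    have "visit_freq x {0..t} \<longlonglongrightarrow> t - 0"
      using ud t unfolding uniformly_distributed_mod1_iff_visit_freq by (metis order_refl less_imp_le)
    then have "(\<lambda>N. visit_freq x {0..t} N - 1) \<longlonglongrightarrow> t - 0 - 1"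
      by (intro tendsto_diff tendsto_const)
    moreover have "eventually (\<lambda>N. visit_freq x {0..t} N - 1 = floor_mean x N t) sequentially"
      using eventually_ge_at_top[of 1]
    proof eventually_elim
      case (elim N)
      have "of_int \<lfloor>t - x n\<rfloor> = of_bool (x n \<in> {0..t}) - (1::real)" if "n \<in> {1..N}" for n
      proof -
        have "\<lfloor>t - x n\<rfloor> = of_bool (x n \<in> {0..t}) - 1"
          using unit[of n] that t by (auto simp: floor_eq_iff)
        then show ?thesis by simp
      qed
      then have "(\<Sum>n=1..N. of_int \<lfloor>t - x n\<rfloor>) = (\<Sum>n=1..N. of_bool (x n \<in> {0..t}) - (1::real))"
        by (intro sum.cong) auto
      also have "\<dots> = (\<Sum>n=1..N. of_bool (x n \<in> {0..t})) - real N"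
        by (simp only: sum_subtractf) simp
      finally show ?case using elim by (simp add: floor_mean_def visit_freq_def field_simps)
    qed
    ultimately show ?thesis by (auto intro: Lim_transform_eventually)
  qed
  \<comment> \<open>Uniform distribution says nothing directly about the degenerate interval
    \<open>{0..0}\<close>. Hence a squeeze: each floor is at least -1, and monotonicity bounds the
    value at 0 by that at a small \<open>u > 0\<close>.\<close>
  have zero: "(\<lambda>N. floor_mean x N 0) \<longlonglongrightarrow> - 1"
  proof (rule order_tendstoI)
    fix a :: real assume a: "a < - 1"
    show "eventually (\<lambda>N. a < floor_mean x N 0) sequentially"
      using eventually_ge_at_top[of 1]
    proof eventually_elim
      case (elim N)
      have "(\<Sum>n=1..N. - 1) \<le> (\<Sum>n=1..N. of_int \<lfloor>0 - x n\<rfloor> :: real)"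
      proof (rule sum_mono)
        fix n assume "n \<in> {1..N}"
        then have "- 1 \<le> \<lfloor>0 - x n\<rfloor>" using unit[of n] by (simp add: le_floor_iff)
        then show "- 1 \<le> (of_int \<lfloor>0 - x n\<rfloor> :: real)" by linarith
      qed
      then have "- 1 \<le> floor_mean x N 0" using elim by (simp add: floor_mean_def field_simps)
      with a show ?case by simp
    qed
  next
    fix a :: real assume a: "- 1 < a"
    define u where "u = min (1 / 2) ((a + 1) / 2)"
    have u: "0 < u" "u < 1" "u - 1 < a" using a by (auto simp: u_def min_def)
    have "eventually (\<lambda>N. floor_mean x N u < a) sequentially"
      using order_tendstoD(2)[OF pos[OF u(1,2)] u(3)] .
    then show "eventually (\<lambda>N. floor_mean x N 0 < a) sequentially"
      by eventually_elim (use floor_mean_mono[of 0 u x] u in \<open>auto intro: le_less_trans\<close>)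
  qed
  have "(\<lambda>N. floor_mean x N (frac t)) \<longlonglongrightarrow> frac t - 1"
  proof (cases "frac t = 0")
    case True
    then show ?thesis using zero by (simp del: frac_eq_0_iff)
  next
    case False
    then show ?thesis using pos[of "frac t"] frac_lt_1[of t] frac_ge_0[of t] by linarith
  qed
  then have "(\<lambda>N. floor_mean x N (frac t) + of_int \<lfloor>t\<rfloor>) \<longlonglongrightarrow> frac t - 1 + of_int \<lfloor>t\<rfloor>"
    by (intro tendsto_intros)
  moreover have "eventually (\<lambda>N. floor_mean x N (frac t) + of_int \<lfloor>t\<rfloor> = floor_mean x N t) sequentially"
    using eventually_ge_at_top[of 1]
    by eventually_elim (simp add: floor_mean_add_int[symmetric] frac_def)
  ultimately show ?thesis by (auto simp: frac_def intro: Lim_transform_eventually)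
qed

text \<open>Monotone functions converging pointwise to a continuous limit converge uniformly on
  compact intervals: control on a finite grid suffices. The interval \<open>{0..2}\<close> contains
  all the arguments \<open>s + x m\<close> that occur later.\<close>

lemma floor_mean_tendsto_uniformly:
  assumes ud: "uniformly_distributed_mod1 x" and e: "0 < e"
  shows "eventually (\<lambda>N. \<forall>t\<in>{0..2}. \<bar>floor_mean x N t - (t - 1)\<bar> < e) sequentially"
proof -
  obtain K :: nat where K: "2 / e < real K" using reals_Archimedean2 by blast
  have K0: "real K > 0" using K e by (smt (verit) divide_pos_pos)
  have Ke: "1 / real K < e / 2" using K K0 e by (simp add: field_simps)
  \<comment> \<open>The index \<open>2 * K + 1\<close> gives \<open>t = 2\<close> a right neighbour
    in the grid.\<close>
  have "eventually (\<lambda>N. \<forall>j\<in>{0..2 * K + 1}. \<bar>floor_mean x N (real j / real K) - (real j / real K - 1)\<bar> < e / 2) sequentially"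
  proof (intro eventually_ball_finite ballI)
    fix j assume "j \<in> {0..2 * K + 1}"
    show "eventually (\<lambda>N. \<bar>floor_mean x N (real j / real K) - (real j / real K - 1)\<bar> < e / 2) sequentially"
      using tendstoD[OF floor_mean_tendsto[OF ud, of "real j / real K"], of "e / 2"] e
      by (simp add: dist_real_def)
  qed simp
  then show ?thesis
  proof eventually_elim
    case (elim N)
    show ?case
    proof
      fix t :: real assume t: "t \<in> {0..2}"
      define j where "j = nat \<lfloor>real K * t\<rfloor>"
      have j: "real j \<le> real K * t" "real K * t < real j + 1"
        using t K0 by (auto simp: j_def)
      have "real K * t \<le> real K * 2" using t by (intro mult_left_mono) auto
      then have j2: "j \<le> 2 * K" using j by linarith
      define u v where "u = real j / real K" and "v = real (Suc j) / real K"
      have uv: "u \<le> t" "t \<le> v" "v = u + 1 / real K"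
        using j K0 by (auto simp: u_def v_def field_simps)
      have "\<bar>floor_mean x N u - (u - 1)\<bar> < e / 2" "\<bar>floor_mean x N v - (v - 1)\<bar> < e / 2"
        using elim[rule_format, of j] elim[rule_format, of "Suc j"] j2
        unfolding u_def v_def by simp_all
      moreover have "floor_mean x N u \<le> floor_mean x N t" "floor_mean x N t \<le> floor_mean x N v"
        using uv by (auto intro: floor_mean_mono)
      ultimately show "\<bar>floor_mean x N t - (t - 1)\<bar> < e" using uv Ke by linarith
    qed
  qed
qed

lemma abs_floor_mean_le:
  assumes "t \<in> {0..1}"
  shows "\<bar>floor_mean x N t\<bar> \<le> 1"
proof -
  have "\<bar>\<Sum>n=1..N. of_int \<lfloor>t - x n\<rfloor> :: real\<bar> \<le> (\<Sum>n=1..N. 1)"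
  proof (rule order_trans[OF sum_abs], rule sum_mono)
    fix n assume "n \<in> {1..N}"
    then have "- 1 \<le> \<lfloor>t - x n\<rfloor>" "\<lfloor>t - x n\<rfloor> \<le> 1"
      using unit[of n] assms by (auto simp: le_floor_iff floor_le_iff)
    then show "\<bar>of_int \<lfloor>t - x n\<rfloor> :: real\<bar> \<le> 1" by linarith
  qed
  then show ?thesis by (cases "N = 0") (auto simp: floor_mean_def field_simps)
qed

text \<open>The integral of \<open>floor_mean x N\<close> over the unit interval is minus the mean
  of the points. By dominated convergence it tends to the integral of \<open>t - 1\<close>.\<close>

lemma mean_tendsto_half:
  assumes ud: "uniformly_distributed_mod1 x"
  shows "(\<lambda>N. (\<Sum>n=1..N. x n) / real N) \<longlonglongrightarrow> 1 / 2"
proof -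
  have int: "(\<integral>t. floor_mean x N t \<partial>unit_lborel) = - ((\<Sum>n=1..N. x n) / real N)" for N
    unfolding floor_mean_def
    by (subst integral_divide_zero, subst Bochner_Integration.integral_sum)
       (auto simp: integrable_floor_diff integral_floor_diff sum_negf)
  have id: "(\<integral>t. t - 1 \<partial>unit_lborel) = - (1 / 2 :: real)"
  proof -
    have "((\<lambda>t. t - 1) has_integral ((1 - 1)\<^sup>2 / 2 - (0 - 1)\<^sup>2 / 2 :: real)) {0..1}"
      by (rule fundamental_theorem_of_calculus)
         (auto intro!: derivative_eq_intros simp flip: has_real_derivative_iff_has_vector_derivative)
    moreover have "set_integrable lborel {0..1} (\<lambda>t::real. t - 1)"
      by (rule borel_integrable_atLeastAtMost') (intro continuous_intros)
    ultimately have "(LINT t:{0..1}|lborel. t - 1) = - (1 / 2 :: real)"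
      by (simp add: set_borel_integral_eq_integral integral_unique)
    then show ?thesis
      by (subst integral_restrict_space) (auto simp: set_lebesgue_integral_def)
  qed
  have "(\<lambda>N. \<integral>t. floor_mean x N t \<partial>unit_lborel) \<longlonglongrightarrow> (\<integral>t. t - 1 \<partial>unit_lborel)"
  proof (rule integral_dominated_convergence[where w = "\<lambda>_. 1"])
    show "floor_mean x N \<in> borel_measurable unit_lborel" for N
      unfolding floor_mean_def[abs_def] by (intro measurable_restrict_space1) simp
    show "AE t in unit_lborel. norm (floor_mean x N t) \<le> 1" for N
      by (rule AE_I2) (use abs_floor_mean_le in \<open>auto simp: space_restrict_space\<close>)
  qed (auto intro!: integrable_unit_lborel measurable_restrict_space1 floor_mean_tendsto[OF ud])
  then show ?thesis
    unfolding int id by (rule tendsto_minus_cancel)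
qed

lemma zero_PPC_if_uniformly_distributed:
  assumes ud: "uniformly_distributed_mod1 x"
  shows "has_zero_PPC x"
  unfolding has_zero_PPC_iff_close_pairs
proof (intro allI impI)
  fix s :: real assume s: "0 < s \<and> s \<le> 1 / 2"
  show "close_pairs x s \<longlonglongrightarrow> 2 * s"
  proof (cases "s = 1 / 2")
    case True
    \<comment> \<open>The floor formula requires \<open>s < 1 / 2\<close>. At
      \<open>s = 1 / 2\<close> every pair is close.\<close>
    have "eventually (\<lambda>N. 1 = close_pairs x s N) sequentially"
      using eventually_ge_at_top[of 1]
      by eventually_elim (simp add: close_pairs_def True dist_nearest_int_le_half[simplified] power2_eq_square)
    then have "close_pairs x s \<longlonglongrightarrow> 1" by (rule Lim_transform_eventually[OF tendsto_const])
    then show ?thesis unfolding True by simp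
  next
    case False
    have err: "(\<lambda>N. (\<Sum>m=1..N. floor_mean x N (s + x m) - (s + x m - 1)) / real N) \<longlonglongrightarrow> 0"
    proof (rule tendstoI)
      fix e :: real assume e: "0 < e"
      then have "0 < e / 2" by simp
      from floor_mean_tendsto_uniformly[OF ud this] eventually_ge_at_top[of 1]
      show "eventually (\<lambda>N. dist ((\<Sum>m=1..N. floor_mean x N (s + x m) - (s + x m - 1)) / real N) 0 < e) sequentially"
      proof eventually_elim
        case (elim N)
        have "\<bar>\<Sum>m=1..N. floor_mean x N (s + x m) - (s + x m - 1)\<bar> \<le> (\<Sum>m=1..N. e / 2)"
        proof (rule order_trans[OF sum_abs], rule sum_mono)
          fix m assume "m \<in> {1..N}"
          then have "s + x m \<in> {0..2}" using unit[of m] s by auto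
          then show "\<bar>floor_mean x N (s + x m) - (s + x m - 1)\<bar> \<le> e / 2"
            using elim by (auto intro: less_imp_le)
        qed
        also have "\<dots> < e * real N" using e elim by simp
        finally show ?case using elim by (simp add: field_simps)
      qed
    qed
    \<comment> \<open>Each \<open>floor_mean x N (s + x m)\<close> is split into its error,
      \<open>x m\<close> and \<open>s - 1\<close>; the limit simplifies to
      \<open>2 * s\<close>.\<close>
    have "(\<lambda>N. 2 * ((\<Sum>m=1..N. floor_mean x N (s + x m) - (s + x m - 1)) / real N
             + (\<Sum>m=1..N. x m) / real N + (s - 1)) + 1) \<longlonglongrightarrow> 2 * (0 + 1 / 2 + (s - 1)) + 1"
      by (intro tendsto_intros err mean_tendsto_half[OF ud])
    moreover have "eventually (\<lambda>N. 2 * ((\<Sum>m=1..N. floor_mean x N (s + x m) - (s + x m - 1)) / real N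
             + (\<Sum>m=1..N. x m) / real N + (s - 1)) + 1 = close_pairs x s N) sequentially"
      using eventually_ge_at_top[of 1]
    proof eventually_elim
      case (elim N)
      have "(\<Sum>m=1..N. floor_mean x N (s + x m) - (s + x m - 1))
          = (\<Sum>m=1..N. floor_mean x N (s + x m)) - (\<Sum>m=1..N. x m) - real N * (s - 1)"
        by (simp add: sum_subtractf sum.distrib algebra_simps)
      then show ?case using elim s False
        by (simp add: close_pairs_eq_floor_mean field_simps)
    qed
    ultimately show ?thesis by (auto intro: Lim_transform_eventually)
  qed
qed

end

section \<open>Zero PPC implies uniform distribution\<close>

text \<open>For \<open>0 \<le> h < 1\<close> this is the indicator, as a function of \<open>t\<close>, of \<open>[x - h, x)\<close> modulo 1.\<close>

definition arc_indicator :: "real \<Rightarrow> real \<Rightarrow> real \<Rightarrow> real" where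
  "arc_indicator h x t = of_int \<lfloor>t - (x - h)\<rfloor> - of_int \<lfloor>t - x\<rfloor>"

lemma arc_indicator_cases:
  assumes "0 \<le> h" "h < 1"
  shows "arc_indicator h x t = 0 \<or> arc_indicator h x t = 1"
proof -
  have "\<lfloor>t - (x - h)\<rfloor> = \<lfloor>t - x\<rfloor> \<or> \<lfloor>t - (x - h)\<rfloor> = \<lfloor>t - x\<rfloor> + 1"
    using assms by linarith
  then show ?thesis by (auto simp: arc_indicator_def)
qed

lemma arc_indicator_add_int: "arc_indicator h (x + of_int k) t = arc_indicator h x t"
proof -
  have "\<lfloor>t - (x + of_int k)\<rfloor> = \<lfloor>t - x\<rfloor> - k" "\<lfloor>t - (x + of_int k - h)\<rfloor> = \<lfloor>t - (x - h)\<rfloor> - k"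
    by linarith+
  then show ?thesis by (simp add: arc_indicator_def)
qed

lemma arc_indicator_measurable [measurable]: "arc_indicator h x \<in> borel_measurable borel"
  unfolding arc_indicator_def[abs_def] by measurable

lemma integrable_arc_indicator: "integrable unit_lborel (arc_indicator h x)"
  unfolding arc_indicator_def[abs_def] by (intro Bochner_Integration.integrable_diff integrable_floor_diff)

lemma integral_arc_indicator: "(\<integral>t. arc_indicator h x t \<partial>unit_lborel) = h"
  unfolding arc_indicator_def by (simp add: integrable_floor_diff integral_floor_diff)

lemma integrable_arc_indicator_mult:
  assumes "0 \<le> h" "h < 1"
  shows "integrable unit_lborel (\<lambda>t. arc_indicator h x t * arc_indicator h y t)"
proof (rule integrable_unit_lborel)
  show "\<bar>arc_indicator h x t * arc_indicator h y t\<bar> \<le> 1" for t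
    using arc_indicator_cases[OF assms, of x t] arc_indicator_cases[OF assms, of y t] by auto
qed measurable

text \<open>The arcs \<open>[x - h, x)\<close> and \<open>[x + d - h, x + d)\<close> can meet only
  in \<open>[x + d - h, x)\<close>, an arc of length \<open>h - d\<close> ending at
  \<open>x\<close>. They do not meet again around the circle, because
  \<open>h + d < 1\<close>.\<close>

lemma integral_arc_indicator_mult_shift_le:
  assumes h: "0 < h" "h < 1 / 2" and d: "0 \<le> d" "d \<le> 1 / 2"
  shows "(\<integral>t. arc_indicator h x t * arc_indicator h (x + d) t \<partial>unit_lborel) \<le> max 0 (h - d)"
proof -
  define g where "g = (\<lambda>t. if d \<le> h then arc_indicator (h - d) x t else 0)"
  have le: "arc_indicator h x t * arc_indicator h (x + d) t \<le> g t" for t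
  proof -
    define A B C D where "A = \<lfloor>t - (x - h)\<rfloor>" and "B = \<lfloor>t - x\<rfloor>"
      and "C = \<lfloor>t - (x + d - h)\<rfloor>" and "D = \<lfloor>t - (x + d)\<rfloor>"
    have fl: "of_int A \<le> t - (x - h)" "t - x < of_int B + 1" "of_int B \<le> t - x"
      "of_int C \<le> t - (x + d - h)" "t - (x + d - h) < of_int C + 1" "t - (x + d) < of_int D + 1"
      unfolding A_def B_def C_def D_def by linarith+
    have arcs: "arc_indicator h x t = of_int A - of_int B" "arc_indicator h (x + d) t = of_int C - of_int D"
      "arc_indicator (h - d) x t = of_int C - of_int B"
      by (simp_all add: arc_indicator_def A_def B_def C_def D_def algebra_simps)
    show ?thesis
    proof (cases "arc_indicator h x t = 1 \<and> arc_indicator h (x + d) t = 1")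
      case True
      then have "A = B + 1" "C = D + 1" using arcs by linarith+
      \<comment> \<open>Indeed \<open>C > t - x - d \<ge> B + 1 - h - d > B\<close>.\<close>
      then have BC: "B < C" using fl h d by linarith
      then have "d \<le> h" using fl by linarith
      with BC True show ?thesis by (simp add: g_def arcs(3))
    next
      case False
      have h1: "0 \<le> h" "h < 1" using h by auto
      have "arc_indicator h x t * arc_indicator h (x + d) t = 0"
        using False arc_indicator_cases[OF h1, of x t] arc_indicator_cases[OF h1, of "x + d" t] by auto
      moreover have "0 \<le> g t"
        using arc_indicator_cases[of "h - d" x t] h d by (auto simp: g_def)
      ultimately show ?thesis by linarith
    qed
  qed
  have "integrable unit_lborel g"
    by (cases "d \<le> h") (simp_all add: g_def integrable_arc_indicator)
  then have "(\<integral>t. arc_indicator h x t * arc_indicator h (x + d) t \<partial>unit_lborel) \<le> (\<integral>t. g t \<partial>unit_lborel)"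
    using h le by (intro integral_mono integrable_arc_indicator_mult) auto
  also have "\<dots> \<le> max 0 (h - d)" by (cases "d \<le> h") (simp_all add: g_def integral_arc_indicator)
  finally show ?thesis .
qed

text \<open>Modulo 1, one of the two points is the other one moved forward by their
  distance.\<close>

lemma integral_arc_indicator_mult_le:
  assumes h: "0 < h" "h < 1 / 2"
  shows "(\<integral>t. arc_indicator h x t * arc_indicator h y t \<partial>unit_lborel) \<le> max 0 (h - dist_nearest_int (x - y))"
proof -
  define d where "d = dist_nearest_int (x - y)"
  obtain k :: int where k: "d = \<bar>x - y - of_int k\<bar>"
    using dist_nearest_int_attained d_def by metis
  have d: "0 \<le> d" "d \<le> 1 / 2" using k dist_nearest_int_le_half[of "x - y"] by (auto simp: d_def)
  consider "x = (y + d) + of_int k" | "y = (x + d) + of_int (- k)"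
    using k by (cases "x - y - of_int k \<ge> 0") auto
  then show ?thesis
  proof cases
    case 1
    then have "arc_indicator h x t = arc_indicator h (y + d) t" for t using arc_indicator_add_int by metis
    then show ?thesis
      using integral_arc_indicator_mult_shift_le[OF h d, of y] by (simp add: d_def mult.commute)
  next
    case 2
    then have "arc_indicator h y t = arc_indicator h (x + d) t" for t using arc_indicator_add_int by metis
    then show ?thesis
      using integral_arc_indicator_mult_shift_le[OF h d, of x] by (simp add: d_def)
  qed
qed

section \<open>Variance of the proportion of points in a moving arc\<close>

text \<open>Modulo 1, \<open>t\<close> lies in \<open>[x n - h, x n)\<close> iff \<open>x n\<close>
  lies in \<open>(t, t + h]\<close>, so for \<open>0 \<le> h < 1\<close> this is the proportion
  \<mu>(t) of points in that arc.\<close>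

definition arc_mean :: "real \<Rightarrow> (nat \<Rightarrow> real) \<Rightarrow> nat \<Rightarrow> real \<Rightarrow> real" where
  "arc_mean h x N t = (\<Sum>n=1..N. arc_indicator h (x n) t) / real N"

lemma arc_mean_measurable [measurable]: "arc_mean h x N \<in> borel_measurable borel"
  unfolding arc_mean_def[abs_def] by measurable

lemma arc_mean_bounds:
  assumes "0 \<le> h" "h < 1"
  shows "0 \<le> arc_mean h x N t" "arc_mean h x N t \<le> 1"
proof -
  have "0 \<le> arc_indicator h (x n) t" "arc_indicator h (x n) t \<le> 1" for n
    using arc_indicator_cases[OF assms, of "x n" t] by auto
  then have "0 \<le> (\<Sum>n=1..N. arc_indicator h (x n) t)" "(\<Sum>n=1..N. arc_indicator h (x n) t) \<le> (\<Sum>n=1..N. 1)"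
    by (auto intro!: sum_nonneg sum_mono simp del: sum_constant)
  then show "0 \<le> arc_mean h x N t" "arc_mean h x N t \<le> 1"
    by (cases "N = 0"; simp add: arc_mean_def)+
qed

definition arc_variance :: "real \<Rightarrow> (nat \<Rightarrow> real) \<Rightarrow> nat \<Rightarrow> real" where
  "arc_variance h x N = (\<integral>t. (arc_mean h x N t - h)\<^sup>2 \<partial>unit_lborel)"

lemma integrable_arc_variance:
  assumes "0 \<le> h" "h < 1"
  shows "integrable unit_lborel (\<lambda>t. (arc_mean h x N t - h)\<^sup>2)"
proof (rule integrable_unit_lborel)
  show "\<bar>(arc_mean h x N t - h)\<^sup>2\<bar> \<le> 1" for t
    using arc_mean_bounds[OF assms, of x N t] assms
    by (simp add: abs_square_le_1)
qed measurable

text \<open>Expand the square: the mean is \<open>h\<close>, and the second moment is the average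
  overlap of the arcs over all pairs.\<close>

lemma arc_variance_le:
  assumes h: "0 < h" "h < 1 / 2" and N: "N \<ge> 1"
  shows "arc_variance h x N
    \<le> (\<Sum>m=1..N. \<Sum>n=1..N. max 0 (h - dist_nearest_int (x m - x n))) / (real N)\<^sup>2 - h\<^sup>2"
proof -
  define P where "P = (\<lambda>t. \<Sum>m=1..N. \<Sum>n=1..N. arc_indicator h (x m) t * arc_indicator h (x n) t)"
  have h1: "0 \<le> h" "h < 1" using h by auto
  have iP: "integrable unit_lborel P"
    unfolding P_def by (intro Bochner_Integration.integrable_sum integrable_arc_indicator_mult h1)
  have im: "integrable unit_lborel (arc_mean h x N)"
    unfolding arc_mean_def[abs_def]
    by (intro Bochner_Integration.integrable_divide Bochner_Integration.integrable_sum integrable_arc_indicator)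
  have Im: "(\<integral>t. arc_mean h x N t \<partial>unit_lborel) = h"
    using N by (simp add: arc_mean_def integrable_arc_indicator integral_arc_indicator)
  have "(arc_mean h x N t - h)\<^sup>2 = P t / (real N)\<^sup>2 - 2 * h * arc_mean h x N t + h\<^sup>2" for t
  proof -
    have "P t / (real N)\<^sup>2 = (arc_mean h x N t)\<^sup>2"
      by (simp add: P_def arc_mean_def power2_eq_square sum_product)
    then show ?thesis by (simp add: power2_eq_square algebra_simps)
  qed
  then have "arc_variance h x N = (\<integral>t. P t / (real N)\<^sup>2 - 2 * h * arc_mean h x N t + h\<^sup>2 \<partial>unit_lborel)"
    by (simp add: arc_variance_def)
  also have "\<dots> = (\<integral>t. P t \<partial>unit_lborel) / (real N)\<^sup>2 - 2 * h * h + h\<^sup>2"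
    using iP im integrable_const_unit_lborel
    by (simp add: Im integral_const_unit_lborel del: integral_const lebesgue_integral_const)
  also have "(\<integral>t. P t \<partial>unit_lborel)
      = (\<Sum>m=1..N. \<Sum>n=1..N. \<integral>t. arc_indicator h (x m) t * arc_indicator h (x n) t \<partial>unit_lborel)"
    unfolding P_def by (simp add: integrable_arc_indicator_mult h1)
  also have "\<dots> / (real N)\<^sup>2 - 2 * h * h + h\<^sup>2
      \<le> (\<Sum>m=1..N. \<Sum>n=1..N. max 0 (h - dist_nearest_int (x m - x n))) / (real N)\<^sup>2 - 2 * h * h + h\<^sup>2"
    by (intro add_mono diff_mono divide_right_mono sum_mono integral_arc_indicator_mult_le h) auto
  finally show ?thesis by (simp add: power2_eq_square)
qed

text \<open>The left side is the integral of \<open>of_bool (d \<le> s)\<close> for \<open>s\<close>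
  from 0 to \<open>K * c\<close>. The right side is its Riemann sum at right endpoints, which is
  larger as the integrand is nondecreasing.\<close>

lemma max_diff_le_sum_of_bool:
  fixes c d :: real
  assumes "0 \<le> c" "0 \<le> d"
  shows "max 0 (real K * c - d) \<le> c * (\<Sum>j=1..K. of_bool (d \<le> real j * c))"
proof (induction K)
  case 0
  then show ?case using assms by simp
next
  case (Suc K)
  have "0 \<le> c * (\<Sum>j=1..K. of_bool (d \<le> real j * c))"
    using assms by (intro mult_nonneg_nonneg sum_nonneg) auto
  with Suc show ?case using assms by (auto simp: algebra_simps simp del: sum_of_bool_eq)
qed

lemma arc_variance_tendsto_0:
  assumes ppc: "has_zero_PPC x" and h: "0 < h" "h < 1 / 2" and e: "0 < e"
  shows "eventually (\<lambda>N. arc_variance h x N < e) sequentially"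
proof -
  \<comment> \<open>With \<open>K\<close> equal steps on \<open>[0, h]\<close>, the right Riemann
    sum of \<open>2 * s\<close> exceeds the integral \<open>h\<^sup>2\<close> by exactly
    \<open>h\<^sup>2 / K\<close>.\<close>
  obtain K :: nat where K: "h\<^sup>2 / e < real K" using reals_Archimedean2 by blast
  have K0: "real K > 0" using K e h by (smt (verit) divide_pos_pos zero_less_power)
  define c where "c = h / real K"
  have c: "0 < c" "real K * c = h" using h K0 by (auto simp: c_def)
  have lim: "(\<lambda>N. c * (\<Sum>j=1..K. close_pairs x (real j * c) N) - h\<^sup>2)
      \<longlonglongrightarrow> c * (\<Sum>j=1..K. 2 * (real j * c)) - h\<^sup>2"
  proof (intro tendsto_intros)
    fix j assume j: "j \<in> {1..K}"
    have "real j * c \<le> real K * c" using j c by (intro mult_right_mono) auto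
    then show "close_pairs x (real j * c) \<longlonglongrightarrow> 2 * (real j * c)"
      using ppc j c h by (auto simp: has_zero_PPC_iff_close_pairs)
  qed
  have "(\<Sum>j=1..n. 2 * (real j * c)) = real n * (real n + 1) * c" for n
    by (induction n) (auto simp: algebra_simps)
  then have "c * (\<Sum>j=1..K. 2 * (real j * c)) - h\<^sup>2 = c * (real K * (real K + 1) * c) - h\<^sup>2"
    by presburger
  also have "\<dots> = h\<^sup>2 / real K"
    using K0 by (simp add: c_def field_simps power2_eq_square)
  also have "\<dots> < e" using K K0 e by (simp add: field_simps)
  finally have "eventually (\<lambda>N. c * (\<Sum>j=1..K. close_pairs x (real j * c) N) - h\<^sup>2 < e) sequentially"
    using order_tendstoD(2)[OF lim] by blast
  then show ?thesis using eventually_ge_at_top[of 1]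
  proof eventually_elim
    case (elim N)
    have "(\<Sum>m=1..N. \<Sum>n=1..N. max 0 (h - dist_nearest_int (x m - x n)))
       \<le> (\<Sum>m=1..N. \<Sum>n=1..N. c * (\<Sum>j=1..K. of_bool (dist_nearest_int (x m - x n) \<le> real j * c)))"
    proof (intro sum_mono)
      fix m n
      have "0 \<le> dist_nearest_int (x m - x n)" by (simp add: dist_nearest_int_def infdist_nonneg)
      then show "max 0 (h - dist_nearest_int (x m - x n))
          \<le> c * (\<Sum>j=1..K. of_bool (dist_nearest_int (x m - x n) \<le> real j * c))"
        using max_diff_le_sum_of_bool[of c "dist_nearest_int (x m - x n)" K] c by simp
    qed
    also have "\<dots> = c * (\<Sum>m=1..N. \<Sum>j=1..K. \<Sum>n=1..N. of_bool (dist_nearest_int (x m - x n) \<le> real j * c))"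
      by (simp only: sum_distrib_left[symmetric]) (subst sum.swap, rule refl)
    also have "\<dots> = c * (\<Sum>j=1..K. \<Sum>m=1..N. \<Sum>n=1..N. of_bool (dist_nearest_int (x m - x n) \<le> real j * c))"
      by (subst sum.swap) (rule refl)
    finally have "(\<Sum>m=1..N. \<Sum>n=1..N. max 0 (h - dist_nearest_int (x m - x n))) / (real N)\<^sup>2
       \<le> c * (\<Sum>j=1..K. \<Sum>m=1..N. \<Sum>n=1..N. of_bool (dist_nearest_int (x m - x n) \<le> real j * c)) / (real N)\<^sup>2"
      by (intro divide_right_mono) auto
    also have "\<dots> = c * (\<Sum>j=1..K. close_pairs x (real j * c) N)"
      by (simp only: close_pairs_def sum_divide_distrib times_divide_eq_right[symmetric])
    finally have "(\<Sum>m=1..N. \<Sum>n=1..N. max 0 (h - dist_nearest_int (x m - x n))) / (real N)\<^sup>2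
       \<le> c * (\<Sum>j=1..K. close_pairs x (real j * c) N)" .
    with arc_variance_le[OF h, of N x] elim show ?case by linarith
  qed
qed

section \<open>From small variance to visit frequencies\<close>

text \<open>If the arc of \<open>x\<close> contains \<open>t\<close>, then \<open>x\<close> lies in
  \<open>(t, t + h]\<close>, which is inside \<open>[a, b]\<close>. There is no wrap-around, as
  \<open>0 \<le> t\<close> and \<open>t + h < 1\<close>.\<close>

lemma arc_indicator_le_of_bool_mult:
  assumes "x \<in> {0..1}" "0 \<le> a" "b \<le> 1" "a \<le> t" "t < b - h" "0 \<le> h" "h < 1"
  shows "arc_indicator h x t \<le> arc_indicator h x t * of_bool (x \<in> {a..b})"
proof (cases "arc_indicator h x t = 0")
  case False
  then have "arc_indicator h x t = 1" using arc_indicator_cases assms by blast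
  then have eq: "\<lfloor>t - (x - h)\<rfloor> = \<lfloor>t - x\<rfloor> + 1" by (simp add: arc_indicator_def)
  have "\<lfloor>t - (x - h)\<rfloor> < 1" using assms by (auto simp: floor_less_iff)
  moreover have "- 1 \<le> \<lfloor>t - x\<rfloor>" using assms by (auto simp: le_floor_iff)
  ultimately have "\<lfloor>t - (x - h)\<rfloor> = 0" "\<lfloor>t - x\<rfloor> = - 1" using eq by linarith+
  then have "t < x" "x \<le> t + h" by (auto simp: floor_eq_iff)
  then show ?thesis using assms by auto
qed simp

context
  fixes x :: "nat \<Rightarrow> real"
  assumes unit: "\<And>n. n \<ge> 1 \<Longrightarrow> x n \<in> {0..1}"
begin

text \<open>Integrate over \<open>t\<close> the contribution \<open>G\<close> of the points in
  \<open>[a, b]\<close>. It is nonnegative, has integral \<open>h * visit_freq x {a..b} N\<close>,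
  and dominates \<open>arc_mean\<close> on \<open>[a, b - h)\<close>, where the variance controls
  the deviation from \<open>h\<close>.\<close>

lemma visit_freq_ge:
  assumes ab: "0 \<le> a" "b \<le> 1" and h: "0 < h" "h < 1" "h < b - a"
  shows "(b - a - h) * (h - h\<^sup>2) - arc_variance h x N / (4 * h\<^sup>2) \<le> h * visit_freq x {a..b} N"
proof -
  have h1: "0 \<le> h" "h < 1" using h by auto
  define V where "V = (\<lambda>t. (arc_mean h x N t - h)\<^sup>2)"
  define G where "G = (\<lambda>t. (\<Sum>n=1..N. arc_indicator h (x n) t * of_bool (x n \<in> {a..b})) / real N)"
  have arc0: "0 \<le> arc_indicator h y t" for y t using arc_indicator_cases[OF h1, of y t] by auto
  have le: "indicator {a..<b - h} t * (h - h\<^sup>2) - V t / (4 * h\<^sup>2) \<le> G t" for t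
  proof (cases "t \<in> {a..<b - h}")
    case True
    \<comment> \<open>AM-GM: \<open>- y \<le> h\<^sup>2 + y\<^sup>2 / (4 h\<^sup>2)\<close> with \<open>y = arc_mean h x N t - h\<close>.\<close>
    have "0 \<le> ((arc_mean h x N t - h) / (2 * h) + h)\<^sup>2" by simp
    also have "\<dots> = V t / (4 * h\<^sup>2) + (arc_mean h x N t - h) + h\<^sup>2"
      using h by (simp add: V_def power2_eq_square field_simps)
    finally have "h - h\<^sup>2 - V t / (4 * h\<^sup>2) \<le> arc_mean h x N t" by simp
    also have "\<dots> \<le> G t"
      unfolding arc_mean_def G_def using True unit ab h1
      by (intro divide_right_mono sum_mono arc_indicator_le_of_bool_mult) auto
    finally show ?thesis using True by simp
  next
    case False
    have "0 \<le> G t" unfolding G_def using arc0 by (intro divide_nonneg_nonneg sum_nonneg) auto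
    moreover have "0 \<le> V t / (4 * h\<^sup>2)" by (simp add: V_def)
    ultimately show ?thesis using False by simp
  qed
  have iV: "integrable unit_lborel V" unfolding V_def by (rule integrable_arc_variance[OF h1])
  have iI: "integrable unit_lborel (indicator {a..<b - h} :: real \<Rightarrow> real)"
    by (rule integrable_unit_lborel[where B = 1]) (auto simp: indicator_def)
  have iG: "integrable unit_lborel G"
    unfolding G_def
    by (intro Bochner_Integration.integrable_divide Bochner_Integration.integrable_sum
        Bochner_Integration.integrable_mult_left integrable_arc_indicator)
  have "{a..<b - h} \<inter> space unit_lborel = {a..<b - h}"
    using ab h by (auto simp: space_restrict_space)
  then have "(\<integral>t. indicator {a..<b - h} t \<partial>unit_lborel) = b - a - h"
    using ab h by (subst Bochner_Integration.integral_indicator, subst measure_unit_lborel) auto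
  then have "(b - a - h) * (h - h\<^sup>2) - arc_variance h x N / (4 * h\<^sup>2)
     = (\<integral>t. indicator {a..<b - h} t * (h - h\<^sup>2) - V t / (4 * h\<^sup>2) \<partial>unit_lborel)"
    using iI iV by (simp add: arc_variance_def V_def)
  also have "\<dots> \<le> (\<integral>t. G t \<partial>unit_lborel)"
    using iI iV iG le by (intro integral_mono) auto
  also have "\<dots> = h * visit_freq x {a..b} N"
    unfolding G_def visit_freq_def
    by (simp add: integrable_arc_indicator integral_arc_indicator sum_distrib_left)
  finally show ?thesis .
qed

lemma eventually_visit_freq_gt:
  assumes ppc: "has_zero_PPC x" and ab: "0 \<le> a" "a < b" "b \<le> 1" and e: "0 < e"
  shows "eventually (\<lambda>N. b - a - e < visit_freq x {a..b} N) sequentially"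
proof -
  \<comment> \<open>The error budget \<open>e\<close> is shared: at most
    \<open>2 * h \<le> e / 2\<close> is lost to the arc length, the rest to the variance.\<close>
  define h where "h = min (1 / 4) (min ((b - a) / 2) (e / 4))"
  have h: "0 < h" "h < 1 / 2" "h < b - a" "2 * h \<le> e / 2"
    using ab e by (auto simp: h_def min_def)
  \<comment> \<open>This threshold is \<open>h * (e / 2)\<close> times \<open>4 * h\<^sup>2\<close>,
    the denominator in \<open>visit_freq_ge\<close>.\<close>
  have "0 < 2 * h ^ 3 * e" using h e by simp
  from arc_variance_tendsto_0[OF ppc h(1,2) this] show ?thesis
  proof eventually_elim
    case (elim N)
    have "h * (e / 2) = (2 * h ^ 3 * e) / (4 * h\<^sup>2)"
      using h by (simp add: field_simps power3_eq_cube power2_eq_square)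
    also have "\<dots> > arc_variance h x N / (4 * h\<^sup>2)"
      using elim h by (intro divide_strict_right_mono) auto
    finally have V: "arc_variance h x N / (4 * h\<^sup>2) < h * (e / 2)" .
    have "(b - a - h) * h\<^sup>2 \<le> 1 * h\<^sup>2" using ab h by (intro mult_right_mono) auto
    then have "h * (b - a - 2 * h) \<le> (b - a - h) * (h - h\<^sup>2)"
      by (simp add: algebra_simps power2_eq_square)
    with V visit_freq_ge[OF ab(1,3), of h N] h
    have "h * (b - a - 2 * h) - h * (e / 2) < h * visit_freq x {a..b} N" by linarith
    then have "h * (b - a - 2 * h - e / 2) < h * visit_freq x {a..b} N" by (simp add: algebra_simps)
    then have "b - a - 2 * h - e / 2 < visit_freq x {a..b} N" using h by simp
    then show ?case using h by linarith
  qed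
qed

lemma eventually_visit_freq_lessThan_gt:
  assumes ppc: "has_zero_PPC x" and a: "0 \<le> a" "a \<le> 1" and e: "0 < e"
  shows "eventually (\<lambda>N. a - e < visit_freq x {..<a} N) sequentially"
proof (cases "a = 0")
  case True
  have "- e < visit_freq x {..<a} N" for N
    using visit_freq_nonneg[of x "{..<a}" N] e by linarith
  then show ?thesis using True by simp
next
  case False
  \<comment> \<open>A closed interval \<open>{0..u}\<close> inside \<open>{..<a}\<close> that loses
    at most \<open>e / 2\<close> in length.\<close>
  define u where "u = max (a / 2) (a - e / 2)"
  have u: "0 < u" "u < a" "a - e / 2 \<le> u" using a e False by (auto simp: u_def)
  have "eventually (\<lambda>N. u - 0 - e / 2 < visit_freq x {0..u} N) sequentially"
    using eventually_visit_freq_gt[OF ppc, of 0 u "e / 2"] u a e by auto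
  then show ?thesis
  proof eventually_elim
    case (elim N)
    have "visit_freq x {0..u} N \<le> visit_freq x {..<a} N" using u by (intro visit_freq_mono) auto
    with elim u show ?case by linarith
  qed
qed

lemma eventually_visit_freq_greaterThan_gt:
  assumes ppc: "has_zero_PPC x" and b: "0 \<le> b" "b \<le> 1" and e: "0 < e"
  shows "eventually (\<lambda>N. 1 - b - e < visit_freq x {b<..} N) sequentially"
proof (cases "b = 1")
  case True
  have "- e < visit_freq x {b<..} N" for N
    using visit_freq_nonneg[of x "{b<..}" N] e by linarith
  then show ?thesis using True by simp
next
  case False
  define u where "u = min ((1 + b) / 2) (b + e / 2)"
  have u: "u < 1" "b < u" "u \<le> b + e / 2" using b e False by (auto simp: u_def min_def)
  have "eventually (\<lambda>N. 1 - u - e / 2 < visit_freq x {u..1} N) sequentially"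
    using eventually_visit_freq_gt[OF ppc, of u 1 "e / 2"] u b e by auto
  then show ?thesis
  proof eventually_elim
    case (elim N)
    have "visit_freq x {u..1} N \<le> visit_freq x {b<..} N" using u by (intro visit_freq_mono) auto
    with elim u show ?case by linarith
  qed
qed

lemma uniformly_distributed_if_zero_PPC:
  assumes ppc: "has_zero_PPC x"
  shows "uniformly_distributed_mod1 x"
  unfolding uniformly_distributed_mod1_iff_visit_freq
proof (intro allI impI)
  fix a b :: real assume ab: "0 \<le> a \<and> a < b \<and> b \<le> 1"
  show "visit_freq x {a..b} \<longlonglongrightarrow> b - a"
  proof (rule tendstoI)
    fix e :: real assume e: "0 < e"
    have lower: "eventually (\<lambda>N. b - a - e < visit_freq x {a..b} N) sequentially"
      using eventually_visit_freq_gt[OF ppc _ _ _ e] ab by blast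
    have left: "eventually (\<lambda>N. a - e / 2 < visit_freq x {..<a} N) sequentially"
      using eventually_visit_freq_lessThan_gt[OF ppc, of a "e / 2"] ab e by auto
    have right: "eventually (\<lambda>N. 1 - b - e / 2 < visit_freq x {b<..} N) sequentially"
      using eventually_visit_freq_greaterThan_gt[OF ppc, of b "e / 2"] ab e by auto
    from lower left right eventually_ge_at_top[of 1]
    show "eventually (\<lambda>N. dist (visit_freq x {a..b} N) (b - a) < e) sequentially"
    proof eventually_elim
      case (elim N)
      \<comment> \<open>The three sets partition the line, so the lower bounds for the two outer
        ones, with error \<open>e / 2\<close> each, give the upper bound for
        \<open>{a..b}\<close>.\<close>
      have "(\<Sum>n=1..N. of_bool (x n \<in> {..<a}) + of_bool (x n \<in> {a..b}) + of_bool (x n \<in> {b<..}))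
          = (\<Sum>n=1..N. 1 :: real)"
        using ab by (intro sum.cong) auto
      then have "visit_freq x {..<a} N + visit_freq x {a..b} N + visit_freq x {b<..} N = 1"
        using elim by (simp only: visit_freq_def sum.distrib add_divide_distrib[symmetric]) simp
      with elim show ?case by (auto simp: dist_real_def abs_if)
    qed
  qed
qed

end

theorem theorem1:
  fixes x :: "nat \<Rightarrow> real"
  assumes "\<And>n. n \<ge> 1 \<Longrightarrow> x n \<in> {0..1}"
  shows "uniformly_distributed_mod1 x \<longleftrightarrow> has_zero_PPC x"
  using zero_PPC_if_uniformly_distributed uniformly_distributed_if_zero_PPC assms by blast

end
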